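(* Let $a\ge b\ge c>0$ be real numbers. The curved surface area of the hemiellipsoid $$y=b\left(1-\frac{x^2}{a^2}-\frac{z^2}{c^2}\right)^{1/2}$$ (whose axis is the positive direction of the $y$-axis) lying above the $x$-$z$ plane (i.e. $y=0$) is given by $$\frac{2\pi b^2c^2}{a^2}\;F_1\left[2;\,\tfrac12,\,\tfrac12;\,\tfrac32;\;1-\frac{b^2}{a^2},\;1-\frac{c^2}{a^2}\right],$$ where $\left|1-\frac{b^2}{a^2}\right|<1$ (i.e. $0<\frac{b^2}{a^2}<2$) and $\left|1-\frac{c^2}{a^2}\right|<1$ (i.e. $0<\frac{c^2}{a^2}<2$).
   Context: The curved surface area of a surface $y=h(x,z)$ whose projection on the $x$-$z$ plane is a region $D$ is $\hat S=\iint_{D}\sqrt{1+\left(\frac{\partial y}{\partial x}\right)^2+\left(\frac{\partial y}{\partial z}\right)^2}\,dx\,dz$ (the flat base is not counted); here $D$ is the elliptical region $\frac{x^2}{a^2}+\frac{z^2}{c^2}\le 1$, the integrand being defined in its interior. Appell's function of the first kind is $$F_1[\alpha;\beta,\gamma;\delta;x,y]=\sum_{m,n=0}^{\infty}\frac{(\alpha)_{m+n}(\beta)_m(\gamma)_n}{(\delta)_{m+n}\,m!\,n!}x^m y^n,\qquad |x|<1,\ |y|<1,$$ where $(\alpha)_0=1$ and $(\alpha)_n=\alpha(\alpha+1)\cdots(\alpha+n-1)$ for $n\ge1$. *)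

theory Defs
  imports "HOL-Analysis.Analysis"
begin

definition area_element :: "(real \<Rightarrow> real \<Rightarrow> real) \<Rightarrow> real \<times> real \<Rightarrow> real" where
  "area_element h = (\<lambda>(x, z). sqrt (1 + (deriv (\<lambda>t. h t z) x)\<^sup>2 + (deriv (\<lambda>t. h x t) z)\<^sup>2))"

(* The partial derivatives of h are only required to exist in the interior of D: for the
   hemiellipsoid they blow up at the boundary of the ellipse, which is a null set. *)
definition curved_surface_area :: "(real \<Rightarrow> real \<Rightarrow> real) \<Rightarrow> (real \<times> real) set \<Rightarrow> real" where
  "curved_surface_area h D = (LINT p:interior D|lborel. area_element h p)"

definition elliptical_region :: "real \<Rightarrow> real \<Rightarrow> (real \<times> real) set" where
  "elliptical_region a c = {(x, z). x\<^sup>2 / a\<^sup>2 + z\<^sup>2 / c\<^sup>2 \<le> 1}"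

definition hemiellipsoid :: "real \<Rightarrow> real \<Rightarrow> real \<Rightarrow> real \<Rightarrow> real \<Rightarrow> real" where
  "hemiellipsoid a b c x z = b * sqrt (1 - x\<^sup>2 / a\<^sup>2 - z\<^sup>2 / c\<^sup>2)"

definition appell_F1_term ::
    "real \<Rightarrow> real \<Rightarrow> real \<Rightarrow> real \<Rightarrow> real \<Rightarrow> real \<Rightarrow> nat \<times> nat \<Rightarrow> real" where
  "appell_F1_term \<alpha> \<beta> \<gamma> \<delta> x y = (\<lambda>(m, n).
     pochhammer \<alpha> (m + n) * pochhammer \<beta> m * pochhammer \<gamma> n
       / (pochhammer \<delta> (m + n) * fact m * fact n) * x ^ m * y ^ n)"

(* Meaningful for \<bar>x\<bar> < 1, \<bar>y\<bar> < 1 and \<delta> not a non-positive integer; the double series then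
   converges absolutely, so the unordered sum is the usual one. *)
definition appell_F1 :: "real \<Rightarrow> real \<Rightarrow> real \<Rightarrow> real \<Rightarrow> real \<Rightarrow> real \<Rightarrow> real" where
  "appell_F1 \<alpha> \<beta> \<gamma> \<delta> x y = (\<Sum>\<^sub>\<infinity>p. appell_F1_term \<alpha> \<beta> \<gamma> \<delta> x y p)"

end

theory Submission
  imports Defs "HOL-Real_Asymp.Real_Asymp"
begin

text \<open>
  Parametrise the surface by the slopes \<open>(p, q)\<close> of its tangent plane instead of \<open>(x, z)\<close>. The open
  ellipse is the bijective image of the whole plane under
  \<open>(p, q) \<mapsto> (a\<^sup>2 p, c\<^sup>2 q) / sqrt (a\<^sup>2 p\<^sup>2 + b\<^sup>2 + c\<^sup>2 q\<^sup>2)\<close> (up to sign), and the area becomes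
  the integral of \<open>a\<^sup>2 b\<^sup>2 c\<^sup>2 sqrt R / (a\<^sup>2 p\<^sup>2 + b\<^sup>2 + c\<^sup>2 q\<^sup>2)\<^sup>2\<close> with \<open>R = 1 + p\<^sup>2 + q\<^sup>2\<close>.
  Since \<open>a\<^sup>2 p\<^sup>2 + b\<^sup>2 + c\<^sup>2 q\<^sup>2 = a\<^sup>2 (R - x - y q\<^sup>2)\<close> for \<open>x = 1 - b\<^sup>2/a\<^sup>2\<close> and \<open>y = 1 - c\<^sup>2/a\<^sup>2\<close>,
  the binomial series for the exponent \<open>-2\<close> expands the integrand into nonnegative terms in
  \<open>x\<close> and \<open>y\<close>; integrating them one by one gives products of Beta functions, which are the
  coefficients of \<open>F\<^sub>1\<close>.
\<close>

section \<open>Substitution on exhausted intervals\<close>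

text \<open>The substitution rule on each compact interval, followed by monotone convergence along
  the exhaustion. This allows substitutions from the whole line or a half-line, where
  \<open>g\<close> need not reach the ends of its range.\<close>

lemma nn_integral_substitution_Union:
  fixes f :: "real \<Rightarrow> ennreal" and g g' :: "real \<Rightarrow> real" and lo hi :: "nat \<Rightarrow> real"
  assumes f [measurable]: "f \<in> borel_measurable borel"
    and g [measurable]: "g \<in> borel_measurable borel" and g' [measurable]: "g' \<in> borel_measurable borel"
    and lo: "decseq lo" and hi: "incseq hi" and lohi: "\<And>k. lo k < hi k"
    and deriv: "\<And>k x. x \<in> {lo k..hi k} \<Longrightarrow> (g has_real_derivative g' x) (at x)"
    and cont: "\<And>k. continuous_on {lo k..hi k} g'"
    and nonneg: "\<And>k x. x \<in> {lo k..hi k} \<Longrightarrow> g' x \<ge> 0"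
  shows "(\<integral>\<^sup>+x. f x * indicator (\<Union>k. {g (lo k)..g (hi k)}) x \<partial>lborel)
       = (\<integral>\<^sup>+x. f (g x) * ennreal (g' x) * indicator (\<Union>k. {lo k..hi k}) x \<partial>lborel)"
proof -
  have inc: "incseq (\<lambda>k. {lo k..hi k})"
    using lo hi by (fastforce simp: incseq_def decseq_def intro: order_trans)
  \<comment> \<open>Monotonicity of \<open>g\<close> is needed only to see that the image intervals
    increase as well.\<close>
  have g_mono: "g x \<le> g y" if "lo k \<le> x" "x \<le> y" "y \<le> hi k" for x y k
    by (rule DERIV_nonneg_imp_nondecreasing[OF \<open>x \<le> y\<close>])
       (use that in \<open>auto intro!: exI[of _ "g' _"] deriv[of _ k] nonneg[of _ k]\<close>)
  have inc': "incseq (\<lambda>k. {g (lo k)..g (hi k)})"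
  proof (rule incseq_SucI)
    fix k
    have "lo (Suc k) \<le> lo k" "hi k \<le> hi (Suc k)" "lo k < hi k"
      using lo hi lohi by (auto simp: decseq_Suc_iff incseq_Suc_iff)
    then have "g (lo (Suc k)) \<le> g (lo k)" "g (hi k) \<le> g (hi (Suc k))"
      by (auto intro!: g_mono[of "Suc k"])
    then show "{g (lo k)..g (hi k)} \<subseteq> {g (lo (Suc k))..g (hi (Suc k))}" by auto
  qed
  \<comment> \<open>Monotone convergence over increasing sets. It is used for both sides of the
    claim, whose approximants agree for every \<open>k\<close>, so the limits agree.\<close>
  have lim: "(\<lambda>k. \<integral>\<^sup>+x. h x * indicator (A k) x \<partial>lborel) \<longlonglongrightarrow> (\<integral>\<^sup>+x. h x * indicator (\<Union>k. A k) x \<partial>lborel)"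
    if [measurable]: "h \<in> borel_measurable borel" "\<And>k. A k \<in> sets borel" and "incseq A" 
    for h :: "real \<Rightarrow> ennreal" and A :: "nat \<Rightarrow> real set"
  proof (rule nn_integral_LIMSEQ)
    show "incseq (\<lambda>k x. h x * indicator (A k) x)"
      using \<open>incseq A\<close> by (auto simp: incseq_def le_fun_def split: split_indicator)
    show "(\<lambda>k. h x * indicator (A k) x) \<longlonglongrightarrow> h x * indicator (\<Union>k. A k) x" for x
    proof (cases "x \<in> (\<Union>k. A k)")
      case True
      then obtain k where "x \<in> A k" by auto
      then have "eventually (\<lambda>i. x \<in> A i) sequentially"
        using \<open>incseq A\<close> by (auto simp: incseq_def eventually_sequentially intro!: exI[of _ k])
      then show ?thesis
        using True by (auto intro!: tendsto_eventually elim!: eventually_mono)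
    qed simp
  qed simp
  have "(\<integral>\<^sup>+x. f x * indicator {g (lo k)..g (hi k)} x \<partial>lborel)
       = (\<integral>\<^sup>+x. f (g x) * ennreal (g' x) * indicator {lo k..hi k} x \<partial>lborel)" for k
    by (rule nn_integral_substitution_aux) (use deriv cont nonneg lohi in auto)
  with lim[of f, OF _ _ inc'] lim[of "\<lambda>x. f (g x) * ennreal (g' x)", OF _ _ inc]
  show ?thesis by (auto intro: LIMSEQ_unique)
qed

text \<open>The two exhaustions used below. \<open>Suc k\<close> keeps the intervals nondegenerate
  at \<open>k = 0\<close>, as the strict inequality \<open>lo k < hi k\<close> demands.\<close>

lemma UN_atLeastAtMost_real_of_nat:
  "(\<Union>k. {- real (Suc k)..real (Suc k)}) = UNIV" "(\<Union>k. {0..real (Suc k)}) = {0..}"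
proof -
  have *: "\<exists>k. - real (Suc k) \<le> x \<and> x \<le> real (Suc k)" for x :: real
  proof -
    obtain k where "\<bar>x\<bar> \<le> real k" using real_arch_simple by blast
    then show ?thesis by (intro exI[of _ k]) auto
  qed
  show "(\<Union>k. {- real (Suc k)..real (Suc k)}) = UNIV" "(\<Union>k. {0..real (Suc k)}) = {0..}"
    using * by (auto simp del: of_nat_Suc) blast
qed

text \<open>The map \<open>p \<mapsto> w * p / sqrt (p^2 + k)\<close> is odd, increasing and tends
  to \<open>w\<close> at infinity, so it carries the line onto the open interval. Both coordinate
  changes of the area integral are instances of it.\<close>

lemma nn_integral_substitution_interval:
  fixes f :: "real \<Rightarrow> ennreal" and w k :: real
  assumes [measurable]: "f \<in> borel_measurable borel" and w: "w > 0" and k: "k > 0"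
  shows "(\<integral>\<^sup>+x. f x * indicator {-w<..<w} x \<partial>lborel)
       = (\<integral>\<^sup>+p. f (w * p / sqrt (p\<^sup>2 + k)) * ennreal (w * k / sqrt (p\<^sup>2 + k) ^ 3) \<partial>lborel)"
proof -
  define g where "g = (\<lambda>p. w * p / sqrt (p\<^sup>2 + k))"
  have pos: "p\<^sup>2 + k > 0" for p using k by (simp add: add_nonneg_pos)
  have sq: "sqrt (p\<^sup>2 + k) ^ 2 = p\<^sup>2 + k" for p using pos[of p] by simp
  have nz: "sqrt (p\<^sup>2 + k) \<noteq> 0" for p using pos[of p] by simp
  have deriv: "(g has_real_derivative w * k / sqrt (p\<^sup>2 + k) ^ 3) (at p)" for p
  proof -
    define r where "r = sqrt (p\<^sup>2 + k)"
    \<comment> \<open>Eliminating \<open>p * p\<close> in favour of \<open>r * r\<close> makes the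
      numerator of the quotient rule collapse to the constant \<open>w * k\<close>.\<close>
    have r: "r \<noteq> 0" "p * p = r * r - k" using nz[of p] sq[of p] by (auto simp: r_def power2_eq_square)
    have "((\<lambda>p. sqrt (p\<^sup>2 + k)) has_real_derivative p / r) (at p)"
      using pos[of p] by (auto intro!: derivative_eq_intros simp: r_def field_simps)
    from DERIV_divide[OF DERIV_cmult_Id[of w p] this nz]
    have "(g has_real_derivative (w * r - w * p * (p / r)) / (r * r)) (at p)"
      by (simp add: g_def r_def)
    also have "(w * r - w * p * (p / r)) / (r * r) = (w * (r * r) - w * (p * p)) / r ^ 3"
      using r(1) by (simp add: field_simps power3_eq_cube)
    also have "w * (r * r) - w * (p * p) = w * k"
      unfolding r(2) by (simp add: algebra_simps)
    finally show ?thesis by (simp add: r_def)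
  qed
  have odd: "g (- p) = - g p" for p by (simp add: g_def)
  have rng: "(\<Union>i. {g (- real (Suc i))..g (real (Suc i))}) = {-w<..<w}"
  proof (intro set_eqI iffI)
    fix y assume "y \<in> (\<Union>i. {g (- real (Suc i))..g (real (Suc i))})"
    then obtain n where n: "g (- real (Suc n)) \<le> y" "y \<le> g (real (Suc n))" by auto
    have *: "real (Suc n) / sqrt ((real (Suc n))\<^sup>2 + k) < 1"
      using k pos[of "real (Suc n)"] by (simp add: real_less_rsqrt divide_less_eq del: of_nat_Suc)
    have "w * (real (Suc n) / sqrt ((real (Suc n))\<^sup>2 + k)) < w * 1"
      using * w by (intro mult_strict_left_mono)
    then have "g (real (Suc n)) < w" by (simp add: g_def)
    with n show "y \<in> {-w<..<w}" unfolding odd by auto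
  next
    fix y assume y: "y \<in> {-w<..<w}"
    have "(g \<longlongrightarrow> w * 1) at_top"
      unfolding g_def using k by real_asymp
    then have "eventually (\<lambda>p. g p > \<bar>y\<bar>) at_top"
      using y by (intro order_tendstoD(1)) auto
    then obtain N where N: "\<And>p. p \<ge> N \<Longrightarrow> g p > \<bar>y\<bar>" by (auto simp: eventually_at_top_linorder)
    obtain n where "real n \<ge> N" using real_arch_simple by blast
    then have "g (real (Suc n)) > \<bar>y\<bar>" by (intro N) auto
    then show "y \<in> (\<Union>i. {g (- real (Suc i))..g (real (Suc i))})" unfolding odd by (intro UN_I[of n]) auto
  qed
  have "continuous_on A (\<lambda>p. w * k / sqrt (p\<^sup>2 + k) ^ 3)" for A
    using nz by (intro continuous_intros) auto
  then have "(\<integral>\<^sup>+x. f x * indicator (\<Union>i. {g (- real (Suc i))..g (real (Suc i))}) x \<partial>lborel)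
      = (\<integral>\<^sup>+p. f (g p) * ennreal (w * k / sqrt (p\<^sup>2 + k) ^ 3) * indicator (\<Union>i. {- real (Suc i)..real (Suc i)}) p \<partial>lborel)"
    using deriv w k pos
    by (intro nn_integral_substitution_Union)
       (auto simp: g_def incseq_def decseq_def intro!: divide_nonneg_nonneg zero_le_power add_nonneg_nonneg)
  then show ?thesis unfolding rng UN_atLeastAtMost_real_of_nat by (simp add: g_def)
qed

section \<open>Beta integrals and moments over the plane\<close>

text \<open>On the half-line, \<open>t = q^2 / (1 + q^2)\<close> turns Euler's Beta integral into
  twice this integrand; the factor 2 pays for the other half-line by evenness.\<close>

lemma nn_integral_even_power_times_powr:
  fixes n :: nat and r :: real
  assumes r: "r > 0"
  shows "(\<integral>\<^sup>+q. ennreal (q ^ (2 * n) * (1 + q\<^sup>2) powr - (real n + 1/2 + r)) \<partial>lborel)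
       = ennreal (Beta (real n + 1/2) r)"
proof -
  define h where "h = (\<lambda>q::real. ennreal (q ^ (2 * n) * (1 + q\<^sup>2) powr - (real n + 1/2 + r)))"
  define f where "f = (\<lambda>t::real. ennreal (t powr (real n - 1/2) * (1 - t) powr (r - 1)))"
  define g where "g = (\<lambda>q::real. q\<^sup>2 / (1 + q\<^sup>2))"
  define g' where "g' = (\<lambda>q::real. 2 * q / (1 + q\<^sup>2)\<^sup>2)"
  have pos: "1 + q\<^sup>2 > 0" for q :: real by (simp add: add_pos_nonneg)
  then have nz: "1 + q\<^sup>2 \<noteq> 0" for q :: real by (metis less_irrefl)
  have [measurable]: "h \<in> borel_measurable borel" "f \<in> borel_measurable borel"
    "g \<in> borel_measurable borel" "g' \<in> borel_measurable borel"
    unfolding h_def f_def g_def g'_def by measurable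
  have deriv: "(g has_real_derivative g' q) (at q)" for q
    unfolding g_def g'_def using nz[of q]
    by (auto intro!: derivative_eq_intros simp: field_simps power2_eq_square)
  have rng: "(\<Union>k. {g 0..g (real (Suc k))}) = {0..<1}"
  proof (intro set_eqI iffI)
    fix y assume "y \<in> (\<Union>k. {g 0..g (real (Suc k))})"
    then show "y \<in> {0..<1}"
      using pos by (auto simp: g_def elim!: le_less_trans)
  next
    fix y :: real assume y: "y \<in> {0..<1}"
    have "(g \<longlongrightarrow> 1) at_top"
      unfolding g_def by real_asymp
    then have "eventually (\<lambda>p. g p > y) at_top"
      using y by (intro order_tendstoD(1)) auto
    then obtain N where N: "\<And>p. p \<ge> N \<Longrightarrow> g p > y" by (auto simp: eventually_at_top_linorder)
    obtain k where "real k \<ge> N" using real_arch_simple by blast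
    then have "g (real (Suc k)) > y" by (intro N) auto
    then show "y \<in> (\<Union>k. {g 0..g (real (Suc k))})" using y by (intro UN_I[of k]) (auto simp: g_def)
  qed
  \<comment> \<open>The restriction to positive \<open>q\<close> matters: for \<open>n = 0\<close>
    the left side vanishes at \<open>q = 0\<close>, while \<open>h 0 = 1\<close>. The point is later
    discarded as a null set.\<close>
  have fg: "f (g q) * ennreal (g' q) = 2 * h q" if "q > 0" for q
  proof -
    let ?u = "1 + q\<^sup>2"
    have "(g q) powr (real n - 1/2) * (1 - g q) powr (r - 1) * g' q
        = (q\<^sup>2) powr (real n - 1/2) / ?u powr (real n - 1/2) * (1 / ?u powr (r - 1)) * (2 * q / ?u powr 2)"
    proof -
      have "1 - g q = 1 / ?u" using nz[of q] by (simp add: g_def field_simps)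
      then show ?thesis using pos[of q] that
        by (simp add: g_def g'_def powr_divide)
    qed
    also have "\<dots> = 2 * ((q\<^sup>2) powr (real n - 1/2) * q) * (1 / (?u powr (real n - 1/2) * ?u powr (r - 1) * ?u powr 2))"
      by (simp add: field_simps)
    also have "(q\<^sup>2) powr (real n - 1/2) * q = q ^ (2 * n)"
    proof -
      have "(q\<^sup>2) powr (real n - 1/2) = q powr (2 * real n - 1)"
        using that by (simp add: powr_powr algebra_simps flip: powr_numeral)
      also have "\<dots> * q = q powr (2 * real n)"
        using that by (simp add: powr_diff)
      also have "\<dots> = q ^ (2 * n)"
        using that powr_realpow[of q "2 * n"] by simp
      finally show ?thesis .
    qed
    also have "1 / (?u powr (real n - 1/2) * ?u powr (r - 1) * ?u powr 2) = ?u powr - (real n + 1/2 + r)"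
    proof -
      have "real n - 1/2 + (r - 1) + 2 = real n + 1/2 + r" by simp
      then have "?u powr (real n - 1/2) * ?u powr (r - 1) * ?u powr 2 = ?u powr (real n + 1/2 + r)"
        by (simp only: powr_add[symmetric])
      then show ?thesis by (simp only: powr_minus_divide)
    qed
    finally have *: "(g q) powr (real n - 1/2) * (1 - g q) powr (r - 1) * g' q
        = 2 * q ^ (2 * n) * ?u powr - (real n + 1/2 + r)" .
    have "f (g q) * ennreal (g' q) = ennreal ((g q) powr (real n - 1/2) * (1 - g q) powr (r - 1) * g' q)"
      unfolding f_def by (rule ennreal_mult'[symmetric]) simp
    also have "\<dots> = ennreal (2 * (q ^ (2 * n) * ?u powr - (real n + 1/2 + r)))"
      unfolding * by (simp only: mult.assoc)
    also have "\<dots> = 2 * h q"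
      unfolding h_def by (subst ennreal_mult') simp_all
    finally show ?thesis .
  qed
  have half: "(\<integral>\<^sup>+q. h q * indicator {..0} q \<partial>lborel) = (\<integral>\<^sup>+q. h q * indicator {0..} q \<partial>lborel)"
    by (subst nn_integral_real_affine[of _ "-1" 0])
       (auto simp: indicator_def h_def intro!: nn_integral_cong)
  have "((\<lambda>t. t powr (real n - 1/2) * (1 - t) powr (r - 1)) has_integral Beta (real n + 1/2) r) {0..1}"
    using has_integral_Beta_real[of "real n + 1/2" r] r by simp
  from nn_integral_has_integral_lebesgue[OF _ this]
  have "ennreal (Beta (real n + 1/2) r) = (\<integral>\<^sup>+t. f t * indicator {0..1} t \<partial>lborel)"
    by (simp add: f_def mult.commute ennreal_mult' ennreal_indicator)
  \<comment> \<open>\<open>g\<close> never attains the value 1, so its range lacks the right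
    endpoint, again a null set.\<close>
  also have "\<dots> = (\<integral>\<^sup>+t. f t * indicator (\<Union>k. {g 0..g (real (Suc k))}) t \<partial>lborel)"
    unfolding rng by (intro nn_integral_cong_AE AE_I[of _ _ "{1}"]) (auto simp: indicator_def)
  also have "\<dots> = (\<integral>\<^sup>+q. f (g q) * ennreal (g' q) * indicator (\<Union>k. {0..real (Suc k)}) q \<partial>lborel)"
    using nz by (intro nn_integral_substitution_Union deriv)
       (auto simp: g'_def incseq_def decseq_def intro!: continuous_intros)
  also have "\<dots> = (\<integral>\<^sup>+q. 2 * (h q * indicator {0..} q) \<partial>lborel)"
    unfolding UN_atLeastAtMost_real_of_nat
  proof (intro nn_integral_cong_AE)
    show "AE q in lborel. f (g q) * ennreal (g' q) * indicator {0..} q = 2 * (h q * indicator {0..} q)"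
      using AE_lborel_singleton[of "0 :: real"]
    proof eventually_elim
      case (elim q)
      then show ?case by (cases "q > 0") (simp_all add: fg)
    qed
  qed
  also have "\<dots> = (\<integral>\<^sup>+q. h q * indicator {..0} q \<partial>lborel) + (\<integral>\<^sup>+q. h q * indicator {0..} q \<partial>lborel)"
    unfolding half mult_2[symmetric] by (rule nn_integral_cmult) simp
  also have "\<dots> = (\<integral>\<^sup>+q. h q * indicator {..0} q + h q * indicator {0..} q \<partial>lborel)"
    by (intro nn_integral_add[symmetric]) auto
  \<comment> \<open>The two closed half-lines overlap only at the origin.\<close>
  also have "\<dots> = (\<integral>\<^sup>+q. h q \<partial>lborel)"
    by (intro nn_integral_cong_AE AE_I[of _ _ "{0}"]) (auto simp: indicator_def)
  finally show ?thesis by (simp add: h_def)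
qed

text \<open>Rescaling \<open>p\<close> by \<open>sqrt k\<close> pulls out the power of
  \<open>k\<close> and leaves the preceding integral with \<open>n = 0\<close> and
  \<open>r = s - 1/2\<close>.\<close>

lemma nn_integral_add_square_powr:
  fixes k s :: real
  assumes k: "k > 0" and s: "s > 1/2"
  shows "(\<integral>\<^sup>+p. ennreal ((k + p\<^sup>2) powr - s) \<partial>lborel) = ennreal (k powr (1/2 - s) * Beta (1/2) (s - 1/2))"
proof -
  have "(\<integral>\<^sup>+p. ennreal ((k + p\<^sup>2) powr - s) \<partial>lborel)
      = ennreal (sqrt k) * (\<integral>\<^sup>+p. ennreal ((k + (sqrt k * p)\<^sup>2) powr - s) \<partial>lborel)"
    using k by (subst nn_integral_real_affine[of _ "sqrt k" 0]) auto
  also have "(\<lambda>p. ennreal ((k + (sqrt k * p)\<^sup>2) powr - s))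
      = (\<lambda>p. ennreal (k powr - s) * ennreal (p ^ (2 * 0) * (1 + p\<^sup>2) powr - (real 0 + 1/2 + (s - 1/2))))"
  proof
    fix p
    have "k + (sqrt k * p)\<^sup>2 = k * (1 + p\<^sup>2)" using k by (simp add: power_mult_distrib algebra_simps)
    then show "ennreal ((k + (sqrt k * p)\<^sup>2) powr - s)
        = ennreal (k powr - s) * ennreal (p ^ (2 * 0) * (1 + p\<^sup>2) powr - (real 0 + 1/2 + (s - 1/2)))"
      using k by (simp add: powr_mult add_nonneg_nonneg flip: ennreal_mult)
  qed
  also have "(\<integral>\<^sup>+p. ennreal (k powr - s) * ennreal (p ^ (2 * 0) * (1 + p\<^sup>2) powr - (real 0 + 1/2 + (s - 1/2))) \<partial>lborel)
      = ennreal (k powr - s) * ennreal (Beta (1/2) (s - 1/2))"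
    using nn_integral_even_power_times_powr[of "s - 1/2" 0] s
    by (subst nn_integral_cmult) auto
  also have "ennreal (sqrt k) * (ennreal (k powr - s) * ennreal (Beta (1/2) (s - 1/2)))
      = ennreal (sqrt k * k powr - s * Beta (1/2) (s - 1/2))"
    using k by (simp add: ennreal_mult' mult.assoc)
  also have "sqrt k * k powr - s = k powr (1/2 - s)"
    using k by (simp only: powr_half_sqrt[symmetric] powr_add[symmetric] diff_conv_add_uminus less_imp_le)
  finally show ?thesis .
qed

text \<open>\<open>Gamma (1 + m + n)\<close> cancels between the two factors. What remains besides
  Pochhammer symbols is \<open>Gamma (1/2)^3 / Gamma (3/2) = 2 * pi\<close>.\<close>

lemma Beta_product_eq_pochhammer:
  fixes m n :: nat
  shows "Beta (1/2) (1 + real m + real n) * Beta (real n + 1/2) (real m + 1/2)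
    = 2 * pi * pochhammer (1/2) m * pochhammer (1/2) n / pochhammer (3/2) (m + n)"
proof -
  have nonint: "(1/2 :: real) \<notin> \<int>\<^sub>\<le>\<^sub>0" "(3/2 :: real) \<notin> \<int>\<^sub>\<le>\<^sub>0"
    by (auto elim!: nonpos_Ints_cases)
  have G: "Gamma (3/2 :: real) = sqrt pi / 2"
    using Gamma_plus1[OF nonint(1)] by (simp add: Gamma_one_half_real)
  have arg: "1/2 + (1 + real m + real n) = 3/2 + real (m + n)"
    "1/2 + real n + (1/2 + real m) = 1 + real m + real n"
    "real n + 1/2 = 1/2 + real n" "real m + 1/2 = 1/2 + real m" by simp_all
  have "Gamma (1 + real m + real n) \<noteq> 0"
    by (rule less_imp_neq[symmetric]) (simp add: Gamma_real_pos)
  then show ?thesis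
    unfolding Beta_def arg pochhammer_Gamma[OF nonint(1)] pochhammer_Gamma[OF nonint(2)] G Gamma_one_half_real
    by (simp add: divide_simps del: of_nat_add)
qed

text \<open>The inner integral is the rescaled one with \<open>k = 1 + q^2\<close>; the power of
  \<open>1 + q^2\<close> that it leaves makes the outer integral a Beta integral. For
  \<open>m = n = 0\<close> the value is the area of the unit hemisphere in slope
  coordinates.\<close>

lemma nn_integral_spherical_moment:
  fixes m n :: nat
  shows "(\<integral>\<^sup>+q. \<integral>\<^sup>+p. ennreal (q ^ (2 * n) * (1 + p\<^sup>2 + q\<^sup>2) powr - (3/2 + real m + real n)) \<partial>lborel \<partial>lborel)
       = ennreal (2 * pi * pochhammer (1/2) m * pochhammer (1/2) n / pochhammer (3/2) (m + n))"
proof -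
  let ?s = "3/2 + real m + real n" and ?B = "Beta (1/2) (1 + real m + real n)"
  have B: "?B \<ge> 0" by (auto simp: Beta_def intro!: divide_nonneg_nonneg mult_nonneg_nonneg less_imp_le[OF Gamma_real_pos])
  have "(\<integral>\<^sup>+p. ennreal (q ^ (2 * n) * (1 + p\<^sup>2 + q\<^sup>2) powr - ?s) \<partial>lborel)
      = ennreal ?B * ennreal (q ^ (2 * n) * (1 + q\<^sup>2) powr - (real n + 1/2 + (real m + 1/2)))" for q
  proof -
    have "(\<integral>\<^sup>+p. ennreal (q ^ (2 * n) * (1 + p\<^sup>2 + q\<^sup>2) powr - ?s) \<partial>lborel)
       = ennreal (q ^ (2 * n)) * (\<integral>\<^sup>+p. ennreal ((1 + q\<^sup>2 + p\<^sup>2) powr - ?s) \<partial>lborel)"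
      by (simp add: ennreal_mult' add_ac nn_integral_cmult)
    also have "(\<integral>\<^sup>+p. ennreal ((1 + q\<^sup>2 + p\<^sup>2) powr - ?s) \<partial>lborel)
       = ennreal ((1 + q\<^sup>2) powr (1/2 - ?s) * Beta (1/2) (?s - 1/2))"
      by (rule nn_integral_add_square_powr) (auto simp: add_pos_nonneg)
    \<comment> \<open>Splits the exponent so that the outer integral has the Beta form with
      \<open>r = m + 1/2\<close>.\<close>
    also have "1/2 - ?s = - (real n + 1/2 + (real m + 1/2))" by simp
    also have "?s - 1/2 = 1 + real m + real n" by simp
    also have "ennreal (q ^ (2 * n)) * ennreal ((1 + q\<^sup>2) powr - (real n + 1/2 + (real m + 1/2)) * ?B)
       = ennreal (q ^ (2 * n) * ((1 + q\<^sup>2) powr - (real n + 1/2 + (real m + 1/2)) * ?B))"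
      using B by (intro ennreal_mult''[symmetric]) simp
    also have "\<dots> = ennreal (?B * (q ^ (2 * n) * (1 + q\<^sup>2) powr - (real n + 1/2 + (real m + 1/2))))"
      by (simp only: mult_ac)
    also have "\<dots> = ennreal ?B * ennreal (q ^ (2 * n) * (1 + q\<^sup>2) powr - (real n + 1/2 + (real m + 1/2)))"
      by (rule ennreal_mult'[OF B])
    finally show ?thesis .
  qed
  then have "(\<integral>\<^sup>+q. \<integral>\<^sup>+p. ennreal (q ^ (2 * n) * (1 + p\<^sup>2 + q\<^sup>2) powr - ?s) \<partial>lborel \<partial>lborel)
    = ennreal ?B * (\<integral>\<^sup>+q. ennreal (q ^ (2 * n) * (1 + q\<^sup>2) powr - (real n + 1/2 + (real m + 1/2))) \<partial>lborel)"
    by (simp add: nn_integral_cmult)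
  also have "\<dots> = ennreal ?B * ennreal (Beta (real n + 1/2) (real m + 1/2))"
    by (subst nn_integral_even_power_times_powr) auto
  finally show ?thesis
    using B unfolding Beta_product_eq_pochhammer[symmetric] by (simp add: ennreal_mult')
qed

section \<open>The binomial series for the exponent -2 in two variables\<close>

text \<open>Grouping the terms by \<open>k = m + n\<close>, the binomial theorem and
  \<open>(2)_k = (k + 1)!\<close> give \<open>(k + 1) * (X + Y)^k\<close>, which is the
  differentiated geometric series.\<close>

lemma has_sum_negative_binomial_two:
  fixes X Y :: real
  assumes X: "X \<ge> 0" and Y: "Y \<ge> 0" and XY: "X + Y < 1"
  shows "((\<lambda>(m, n). pochhammer 2 (m + n) / (fact m * fact n) * X ^ m * Y ^ n) has_sum 1 / (1 - X - Y)\<^sup>2) UNIV"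
proof -
  let ?f = "\<lambda>(m, n). pochhammer 2 (m + n) / (fact m * fact n) * X ^ m * Y ^ n"
  let ?h = "\<lambda>(k, m). ?f (m, k - m)"
  have inner: "((\<lambda>m. ?h (k, m)) has_sum real (Suc k) * (X + Y) ^ k) {..k}" for k
  proof -
    have "pochhammer 2 k = (fact (Suc k) :: real)"
      by (simp add: pochhammer_fact pochhammer_rec[of 1 k])
    then have "?h (k, m) = real (Suc k) * (of_nat (k choose m) * X ^ m * Y ^ (k - m))" if "m \<le> k" for m
      using that by (simp add: binomial_fact field_simps)
    then have "(\<Sum>m\<le>k. ?h (k, m)) = real (Suc k) * (X + Y) ^ k"
      unfolding binomial_ring by (simp add: sum_distrib_left)
    then show ?thesis using has_sum_finite[of "{..k}" "\<lambda>m. ?h (k, m)"] by simp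
  qed
  have "(\<lambda>k. real (Suc k) * (X + Y) ^ k) sums (1 / (1 - (X + Y))\<^sup>2)"
    using X Y XY geometric_deriv_sums[of "X + Y"] by simp
  then have outer: "((\<lambda>k. real (Suc k) * (X + Y) ^ k) has_sum 1 / (1 - (X + Y))\<^sup>2) UNIV"
    using X Y by (intro sums_nonneg_imp_has_sum) auto
  have "(?h has_sum 1 / (1 - (X + Y))\<^sup>2) (Sigma UNIV (\<lambda>k. {..k}))"
  proof (rule has_sum_SigmaI[OF inner outer])
    \<comment> \<open>Since the terms are nonnegative, summability over all pairs follows from that
      of the diagonal sums.\<close>
    show "?h summable_on (Sigma UNIV (\<lambda>k. {..k}))"
      using X Y by (intro summable_on_SigmaI[OF inner has_sum_imp_summable[OF outer]])
        (auto simp: pochhammer_nonneg)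
  qed
  moreover have "(?h has_sum 1 / (1 - (X + Y))\<^sup>2) (Sigma UNIV (\<lambda>k. {..k}))
      \<longleftrightarrow> (?f has_sum 1 / (1 - (X + Y))\<^sup>2) UNIV"
    by (rule has_sum_reindex_bij_witness[of _ "\<lambda>(m, n). (m + n, m)" "\<lambda>(k, m). (m, k - m)"]) auto
  ultimately show ?thesis by (simp add: algebra_simps)
qed

section \<open>The hemiellipsoid and its slope coordinates\<close>

text \<open>A point of an open subset of the region can be scaled by some \<open>t > 1\<close>
  without leaving that subset. Its quadratic form times \<open>t^2\<close> is then still at most 1,
  so the form itself is strictly below 1.\<close>

lemma interior_elliptical_region:
  fixes a c :: real
  assumes a: "a > 0" and c: "c > 0"
  shows "interior (elliptical_region a c) = {(x, z). x\<^sup>2 / a\<^sup>2 + z\<^sup>2 / c\<^sup>2 < 1}"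
proof (rule interior_unique)
  have "continuous_on UNIV (\<lambda>p :: real \<times> real. (fst p)\<^sup>2 / a\<^sup>2 + (snd p)\<^sup>2 / c\<^sup>2)"
    using a c by (intro continuous_intros) auto
  then have "open {p :: real \<times> real. (fst p)\<^sup>2 / a\<^sup>2 + (snd p)\<^sup>2 / c\<^sup>2 < 1}"
    by (intro open_Collect_less continuous_on_const)
  then show "open {(x, z). x\<^sup>2 / a\<^sup>2 + z\<^sup>2 / c\<^sup>2 < 1}"
    by (simp add: case_prod_unfold)
  show "{(x, z). x\<^sup>2 / a\<^sup>2 + z\<^sup>2 / c\<^sup>2 < 1} \<subseteq> elliptical_region a c"
    by (auto simp: elliptical_region_def)
  fix T assume T: "T \<subseteq> elliptical_region a c" "open T"
  show "T \<subseteq> {(x, z). x\<^sup>2 / a\<^sup>2 + z\<^sup>2 / c\<^sup>2 < 1}"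
  proof clarify
    fix x z assume xz: "(x, z) \<in> T"
    have "((\<lambda>t. t *\<^sub>R (x, z)) \<longlongrightarrow> 1 *\<^sub>R (x, z)) (at_right (1::real))"
      by (intro tendsto_intros)
    then have "eventually (\<lambda>t. t *\<^sub>R (x, z) \<in> T) (at_right (1::real))"
      using T(2) xz by (intro topological_tendstoD) auto
    then obtain t :: real where t: "t > 1" "t *\<^sub>R (x, z) \<in> T"
      by (metis (no_types, lifting) dense eventually_at_right_field)
    with T(1) have "t\<^sup>2 * (x\<^sup>2 / a\<^sup>2 + z\<^sup>2 / c\<^sup>2) \<le> 1"
      by (force simp: elliptical_region_def power_mult_distrib distrib_left)
    moreover have "t\<^sup>2 > 1" using t(1) by (simp add: one_less_power)
    moreover have "u < 1" if "t\<^sup>2 * u \<le> 1" "t\<^sup>2 > 1" for u :: real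
    proof (rule ccontr)
      assume "\<not> u < 1"
      then have "t\<^sup>2 * 1 \<le> t\<^sup>2 * u" using that by (intro mult_left_mono) auto
      then show False using that by linarith
    qed
    ultimately show "x\<^sup>2 / a\<^sup>2 + z\<^sup>2 / c\<^sup>2 < 1" by blast
  qed
qed

text \<open>The slopes are \<open>- b * x / (a^2 * sqrt w)\<close> and
  \<open>- b * z / (c^2 * sqrt w)\<close>, where the radicand \<open>w\<close> is positive inside
  the ellipse and the square root is therefore differentiable.\<close>

lemma area_element_hemiellipsoid:
  fixes a b c x z :: real
  assumes "a > 0" "c > 0" and inside: "x\<^sup>2 / a\<^sup>2 + z\<^sup>2 / c\<^sup>2 < 1"
  shows "area_element (hemiellipsoid a b c) (x, z)
    = sqrt (1 + (b\<^sup>2 * x\<^sup>2 / a ^ 4 + b\<^sup>2 * z\<^sup>2 / c ^ 4) / (1 - x\<^sup>2 / a\<^sup>2 - z\<^sup>2 / c\<^sup>2))"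
proof -
  define w where "w = 1 - x\<^sup>2 / a\<^sup>2 - z\<^sup>2 / c\<^sup>2"
  have w: "w > 0" using inside by (simp add: w_def)
  have sqrt_deriv: "((\<lambda>t. b * sqrt (\<phi> t)) has_real_derivative b * d / (2 * sqrt w)) (at u)"
    if "(\<phi> has_real_derivative d) (at u)" "\<phi> u = w" for \<phi> :: "real \<Rightarrow> real" and d u
    by (rule DERIV_cong[OF DERIV_cmult[OF DERIV_chain2[OF DERIV_real_sqrt that(1)], of b]])
       (use that(2) w in \<open>simp_all add: field_simps\<close>)
  have "((\<lambda>t. hemiellipsoid a b c t z) has_real_derivative b * (- (2 * x / a\<^sup>2)) / (2 * sqrt w)) (at x)"
    unfolding hemiellipsoid_def
    by (rule sqrt_deriv)
       (use assms in \<open>auto intro!: derivative_eq_intros simp: w_def field_simps power2_eq_square power4_eq_xxxx\<close>)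
  moreover have "((\<lambda>t. hemiellipsoid a b c x t) has_real_derivative b * (- (2 * z / c\<^sup>2)) / (2 * sqrt w)) (at z)"
    unfolding hemiellipsoid_def
    by (rule sqrt_deriv)
       (use assms in \<open>auto intro!: derivative_eq_intros simp: w_def field_simps power2_eq_square power4_eq_xxxx\<close>)
  ultimately show ?thesis
    using w unfolding area_element_def
    by (simp add: DERIV_imp_deriv power_mult_distrib power_divide add_divide_distrib flip: w_def)
qed

text \<open>
  The change of coordinates is triangular, so that two one-dimensional substitutions suffice:
  \<open>x\<close> is replaced by \<open>p\<close> at fixed \<open>z\<close>, then \<open>z\<close> by \<open>q\<close> at fixed \<open>p\<close>.
\<close>
lemma hemiellipsoid_slope_coordinates:
  fixes a b c p q :: real
  assumes a: "a > 0" and b: "b > 0" and c: "c > 0"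
  defines "k \<equiv> b\<^sup>2 / a\<^sup>2" and "l \<equiv> (a\<^sup>2 * p\<^sup>2 + b\<^sup>2) / c\<^sup>2"
  defines "z \<equiv> c * q / sqrt (q\<^sup>2 + l)"
  defines "x \<equiv> a * sqrt (1 - z\<^sup>2 / c\<^sup>2) * p / sqrt (p\<^sup>2 + k)"
  shows "x\<^sup>2 / a\<^sup>2 + z\<^sup>2 / c\<^sup>2 < 1"
    and "(b\<^sup>2 * x\<^sup>2 / a ^ 4 + b\<^sup>2 * z\<^sup>2 / c ^ 4) / (1 - x\<^sup>2 / a\<^sup>2 - z\<^sup>2 / c\<^sup>2) = p\<^sup>2 + q\<^sup>2"
    and "a * sqrt (1 - z\<^sup>2 / c\<^sup>2) * k / sqrt (p\<^sup>2 + k) ^ 3 * (c * l / sqrt (q\<^sup>2 + l) ^ 3)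
       = a\<^sup>2 * b\<^sup>2 * c\<^sup>2 / (a\<^sup>2 * p\<^sup>2 + b\<^sup>2 + c\<^sup>2 * q\<^sup>2)\<^sup>2"
proof -
  \<comment> \<open>These absorb the radicals: \<open>p^2 + k = P / a^2\<close> and
    \<open>q^2 + l = Q / c^2\<close>, and the radicand of the hemiellipsoid becomes
    \<open>b^2 / Q\<close>.\<close>
  define P where "P = a\<^sup>2 * p\<^sup>2 + b\<^sup>2"
  define Q where "Q = P + c\<^sup>2 * q\<^sup>2"
  have P: "P > 0" using b unfolding P_def by (intro add_nonneg_pos) auto
  then have Q: "Q > 0" unfolding Q_def by (intro add_pos_nonneg) auto
  have k: "p\<^sup>2 + k = P / a\<^sup>2" using a by (simp add: k_def P_def field_simps)
  have l: "l = P / c\<^sup>2" "q\<^sup>2 + l = Q / c\<^sup>2" using c by (simp_all add: l_def P_def Q_def field_simps)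
  have rk: "sqrt (p\<^sup>2 + k) = sqrt P / a" and rl: "sqrt (q\<^sup>2 + l) = sqrt Q / c"
    using a c P Q by (simp_all add: k l(2) real_sqrt_divide)
  have z2: "z\<^sup>2 / c\<^sup>2 = c\<^sup>2 * q\<^sup>2 / Q"
    unfolding z_def rl using c Q by (simp add: power_divide power_mult_distrib)
  then have z2': "1 - z\<^sup>2 / c\<^sup>2 = P / Q" using Q by (simp add: Q_def field_simps)
  have "x\<^sup>2 = a\<^sup>2 * (P / Q) * p\<^sup>2 / (P / a\<^sup>2)"
    unfolding x_def z2' rk using a P Q by (simp add: power_divide power_mult_distrib)
  then have x2: "x\<^sup>2 / a\<^sup>2 = a\<^sup>2 * p\<^sup>2 / Q" using a P Q by (simp add: field_simps)
  have w: "1 - x\<^sup>2 / a\<^sup>2 - z\<^sup>2 / c\<^sup>2 = b\<^sup>2 / Q"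
  proof -
    have "1 - x\<^sup>2 / a\<^sup>2 - z\<^sup>2 / c\<^sup>2 = (Q - a\<^sup>2 * p\<^sup>2 - c\<^sup>2 * q\<^sup>2) / Q"
      unfolding x2 z2 using Q by (simp add: diff_divide_distrib)
    also have "Q - a\<^sup>2 * p\<^sup>2 - c\<^sup>2 * q\<^sup>2 = b\<^sup>2" by (simp add: Q_def P_def)
    finally show ?thesis .
  qed
  moreover have "b\<^sup>2 / Q > 0" using b Q by simp
  ultimately show "x\<^sup>2 / a\<^sup>2 + z\<^sup>2 / c\<^sup>2 < 1" by linarith
  have "b\<^sup>2 * x\<^sup>2 / a ^ 4 + b\<^sup>2 * z\<^sup>2 / c ^ 4 = b\<^sup>2 / a\<^sup>2 * (x\<^sup>2 / a\<^sup>2) + b\<^sup>2 / c\<^sup>2 * (z\<^sup>2 / c\<^sup>2)"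
    by (simp add: power4_eq_xxxx power2_eq_square mult.assoc)
  also have "\<dots> = (p\<^sup>2 + q\<^sup>2) * (b\<^sup>2 / Q)"
    unfolding x2 z2 using a c Q by (simp add: field_simps)
  finally show "(b\<^sup>2 * x\<^sup>2 / a ^ 4 + b\<^sup>2 * z\<^sup>2 / c ^ 4) / (1 - x\<^sup>2 / a\<^sup>2 - z\<^sup>2 / c\<^sup>2) = p\<^sup>2 + q\<^sup>2"
    unfolding w using b Q by simp
  \<comment> \<open>Naming the roots of \<open>P\<close> and \<open>Q\<close> turns the Jacobian
    into a rational expression, in which all powers of \<open>r\<close> cancel.\<close>
  define r s where "r = sqrt P" and "s = sqrt Q"
  have rs: "r > 0" "s > 0" "P = r ^ 2" "Q = s ^ 2" using P Q by (auto simp: r_def s_def)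
  have "a * sqrt (1 - z\<^sup>2 / c\<^sup>2) * k / sqrt (p\<^sup>2 + k) ^ 3 * (c * l / sqrt (q\<^sup>2 + l) ^ 3)
     = a * (r / s) * (b\<^sup>2 / a\<^sup>2) / (r / a) ^ 3 * (c * (r\<^sup>2 / c\<^sup>2) / (s / c) ^ 3)"
    unfolding rk rl z2' unfolding l(1) using rs by (simp add: k_def real_sqrt_divide)
  also have "\<dots> = a\<^sup>2 * b\<^sup>2 * c\<^sup>2 / (s\<^sup>2)\<^sup>2"
    using a c rs(1,2) by (simp add: field_simps power_divide eval_nat_numeral)
  also have "s\<^sup>2 = a\<^sup>2 * p\<^sup>2 + b\<^sup>2 + c\<^sup>2 * q\<^sup>2" using rs by (simp add: Q_def P_def)
  finally show "a * sqrt (1 - z\<^sup>2 / c\<^sup>2) * k / sqrt (p\<^sup>2 + k) ^ 3 * (c * l / sqrt (q\<^sup>2 + l) ^ 3)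
       = a\<^sup>2 * b\<^sup>2 * c\<^sup>2 / (a\<^sup>2 * p\<^sup>2 + b\<^sup>2 + c\<^sup>2 * q\<^sup>2)\<^sup>2" .
qed

text \<open>After Tonelli, each substitution stretches a bounded section to the whole line. The new
  point always lies in \<open>D\<close>, so the indicator disappears, and the area element becomes
  \<open>sqrt (1 + p^2 + q^2)\<close>.\<close>

lemma nn_integral_area_hemiellipsoid:
  fixes a b c :: real
  assumes a: "a > 0" and b: "b > 0" and c: "c > 0"
  defines "D \<equiv> {(x, z). x\<^sup>2 / a\<^sup>2 + z\<^sup>2 / c\<^sup>2 < 1}"
  defines "A \<equiv> \<lambda>(x, z). sqrt (1 + (b\<^sup>2 * x\<^sup>2 / a ^ 4 + b\<^sup>2 * z\<^sup>2 / c ^ 4) / (1 - x\<^sup>2 / a\<^sup>2 - z\<^sup>2 / c\<^sup>2))"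
  shows "(\<integral>\<^sup>+v. ennreal (A v) * indicator D v \<partial>lborel)
    = (\<integral>\<^sup>+q. \<integral>\<^sup>+p. ennreal (a\<^sup>2 * b\<^sup>2 * c\<^sup>2 * sqrt (1 + p\<^sup>2 + q\<^sup>2) / (a\<^sup>2 * p\<^sup>2 + b\<^sup>2 + c\<^sup>2 * q\<^sup>2)\<^sup>2) \<partial>lborel \<partial>lborel)"
proof -
  have sf: "pair_sigma_finite (lborel :: real measure) (lborel :: real measure)"
    by (intro pair_sigma_finite.intro sigma_finite_lborel)
  define F where "F = (\<lambda>x z. ennreal (A (x, z)) * indicator D (x, z))"
  \<comment> \<open>With \<open>w = a * sqrt (1 - z^2/c^2)\<close>, the slope in \<open>x\<close> is
    \<open>b * x / (a * sqrt (w^2 - x^2))\<close> up to sign. Solving for \<open>x\<close> gives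
    \<open>X\<close> and the constant \<open>k\<close>; solving the other slope for \<open>z\<close>
    at fixed \<open>p\<close> gives \<open>l p\<close>.\<close>
  define k where "k = b\<^sup>2 / a\<^sup>2"
  define l where "l = (\<lambda>p. (a\<^sup>2 * p\<^sup>2 + b\<^sup>2) / c\<^sup>2)"
  define X where "X = (\<lambda>p z. a * sqrt (1 - z\<^sup>2 / c\<^sup>2) * p / sqrt (p\<^sup>2 + k))"
  define J where "J = (\<lambda>p z. a * sqrt (1 - z\<^sup>2 / c\<^sup>2) * k / sqrt (p\<^sup>2 + k) ^ 3)"
  define G where "G = (\<lambda>p z. F (X p z) z * ennreal (J p z))"
  have k: "k > 0" using a b by (simp add: k_def)
  have l: "l p > 0" for p using b c by (auto simp: l_def intro!: add_nonneg_pos divide_pos_pos)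
  have "D = {v \<in> space (borel \<Otimes>\<^sub>M borel). (fst v)\<^sup>2 / a\<^sup>2 + (snd v)\<^sup>2 / c\<^sup>2 < 1}"
    by (auto simp: D_def space_pair_measure)
  then have D [measurable]: "D \<in> sets (borel \<Otimes>\<^sub>M borel)"
    by simp
  have A [measurable]: "A \<in> borel_measurable (borel \<Otimes>\<^sub>M borel)"
    unfolding A_def by measurable
  have F [measurable]: "case_prod F \<in> borel_measurable (borel \<Otimes>\<^sub>M borel)"
    unfolding F_def by (simp add: case_prod_unfold)
  have [measurable]: "case_prod X \<in> borel_measurable (borel \<Otimes>\<^sub>M borel)" "case_prod J \<in> borel_measurable (borel \<Otimes>\<^sub>M borel)"
    unfolding X_def J_def by measurable
  have G [measurable]: "case_prod G \<in> borel_measurable (borel \<Otimes>\<^sub>M borel)"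
    unfolding G_def by measurable
  have "(\<integral>\<^sup>+v. ennreal (A v) * indicator D v \<partial>lborel) = (\<integral>\<^sup>+z. \<integral>\<^sup>+x. F x z \<partial>lborel \<partial>lborel)"
    unfolding F_def lborel_prod[symmetric]
    by (subst pair_sigma_finite.nn_integral_snd[OF sf, symmetric]) auto
  \<comment> \<open>For z outside the open interval the section of \<open>D\<close> is empty.
    Keeping the indicator provides the domain for the second substitution.\<close>
  also have "\<dots> = (\<integral>\<^sup>+z. \<integral>\<^sup>+p. G p z * indicator {-c<..<c} z \<partial>lborel \<partial>lborel)"
  proof (rule nn_integral_cong)
    fix z :: real
    show "(\<integral>\<^sup>+x. F x z \<partial>lborel) = (\<integral>\<^sup>+p. G p z * indicator {-c<..<c} z \<partial>lborel)"
    proof (cases "\<bar>z\<bar> < c")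
      case False
      then have "z\<^sup>2 / c\<^sup>2 \<ge> 1" using c by (simp add: abs_le_square_iff[symmetric] not_less)
      moreover have "x\<^sup>2 / a\<^sup>2 \<ge> 0" for x by simp
      ultimately have "(x, z) \<notin> D" for x unfolding D_def by (smt (verit) case_prod_conv mem_Collect_eq)
      then have "F x z = 0" for x by (simp add: F_def)
      moreover have "z \<notin> {-c<..<c}" using False by auto
      ultimately show ?thesis by simp
    next
      case True
      define w where "w = a * sqrt (1 - z\<^sup>2 / c\<^sup>2)"
      have "z\<^sup>2 < c\<^sup>2" using True c abs_le_square_iff[of c z] by linarith
      then have v: "1 - z\<^sup>2 / c\<^sup>2 > 0" using c by simp
      then have w: "w > 0" "w\<^sup>2 = a\<^sup>2 * (1 - z\<^sup>2 / c\<^sup>2)" using a by (simp_all add: w_def power_mult_distrib)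
      have "x \<in> {-w<..<w}" if "(x, z) \<in> D" for x
      proof -
        have "x\<^sup>2 < w\<^sup>2" using that a unfolding w(2) by (simp add: D_def field_simps)
        then have "\<bar>x\<bar> < \<bar>w\<bar>" using abs_le_square_iff[of w x] by linarith
        then show ?thesis using w(1) by auto
      qed
      then have "(\<integral>\<^sup>+x. F x z \<partial>lborel) = (\<integral>\<^sup>+x. F x z * indicator {-w<..<w} x \<partial>lborel)"
        by (intro nn_integral_cong) (auto simp: F_def indicator_def)
      also have "\<dots> = (\<integral>\<^sup>+p. G p z \<partial>lborel)"
        using w(1) k by (subst nn_integral_substitution_interval[of _ w k]) (auto simp: G_def X_def J_def w_def)
      finally show ?thesis using True by (simp add: indicator_def abs_less_iff)
    qed
  qed
  also have "\<dots> = (\<integral>\<^sup>+p. \<integral>\<^sup>+z. G p z * indicator {-c<..<c} z \<partial>lborel \<partial>lborel)"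
    by (rule pair_sigma_finite.Fubini'[OF sf]) measurable
  also have "\<dots> = (\<integral>\<^sup>+p. \<integral>\<^sup>+q. G p (c * q / sqrt (q\<^sup>2 + l p)) * ennreal (c * l p / sqrt (q\<^sup>2 + l p) ^ 3) \<partial>lborel \<partial>lborel)"
    using c l by (intro nn_integral_cong nn_integral_substitution_interval) auto
  also have "\<dots> = (\<integral>\<^sup>+p. \<integral>\<^sup>+q. ennreal (a\<^sup>2 * b\<^sup>2 * c\<^sup>2 * sqrt (1 + p\<^sup>2 + q\<^sup>2) / (a\<^sup>2 * p\<^sup>2 + b\<^sup>2 + c\<^sup>2 * q\<^sup>2)\<^sup>2) \<partial>lborel \<partial>lborel)"
  proof (intro nn_integral_cong)
    fix p q :: real
    define z where "z = c * q / sqrt (q\<^sup>2 + l p)"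
    have slope: "(X p z)\<^sup>2 / a\<^sup>2 + z\<^sup>2 / c\<^sup>2 < 1"
      "(b\<^sup>2 * (X p z)\<^sup>2 / a ^ 4 + b\<^sup>2 * z\<^sup>2 / c ^ 4) / (1 - (X p z)\<^sup>2 / a\<^sup>2 - z\<^sup>2 / c\<^sup>2) = p\<^sup>2 + q\<^sup>2"
      "J p z * (c * l p / sqrt (q\<^sup>2 + l p) ^ 3) = a\<^sup>2 * b\<^sup>2 * c\<^sup>2 / (a\<^sup>2 * p\<^sup>2 + b\<^sup>2 + c\<^sup>2 * q\<^sup>2)\<^sup>2"
      unfolding z_def X_def J_def k_def l_def by (rule hemiellipsoid_slope_coordinates[OF a b c])+
    have "c * l p / sqrt (q\<^sup>2 + l p) ^ 3 \<ge> 0"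
      using c l[of p] by (intro divide_nonneg_nonneg mult_nonneg_nonneg zero_le_power) auto
    then have "G p z * ennreal (c * l p / sqrt (q\<^sup>2 + l p) ^ 3)
       = ennreal (sqrt (1 + (p\<^sup>2 + q\<^sup>2)) * (J p z * (c * l p / sqrt (q\<^sup>2 + l p) ^ 3)))"
      using slope(1) unfolding G_def F_def A_def D_def
      by (simp add: slope(2) ennreal_mult' ennreal_mult'' mult.assoc del: times_divide_eq_right)
    also have "\<dots> = ennreal (a\<^sup>2 * b\<^sup>2 * c\<^sup>2 * sqrt (1 + p\<^sup>2 + q\<^sup>2) / (a\<^sup>2 * p\<^sup>2 + b\<^sup>2 + c\<^sup>2 * q\<^sup>2)\<^sup>2)"
      unfolding slope(3) by (simp add: add_ac mult_ac)
    finally show "G p (c * q / sqrt (q\<^sup>2 + l p)) * ennreal (c * l p / sqrt (q\<^sup>2 + l p) ^ 3)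
      = ennreal (a\<^sup>2 * b\<^sup>2 * c\<^sup>2 * sqrt (1 + p\<^sup>2 + q\<^sup>2) / (a\<^sup>2 * p\<^sup>2 + b\<^sup>2 + c\<^sup>2 * q\<^sup>2)\<^sup>2)"
      by (simp add: z_def)
  qed
  \<comment> \<open>Restores the order of integration in which the moments were computed.\<close>
  also have "\<dots> = (\<integral>\<^sup>+q. \<integral>\<^sup>+p. ennreal (a\<^sup>2 * b\<^sup>2 * c\<^sup>2 * sqrt (1 + p\<^sup>2 + q\<^sup>2) / (a\<^sup>2 * p\<^sup>2 + b\<^sup>2 + c\<^sup>2 * q\<^sup>2)\<^sup>2) \<partial>lborel \<partial>lborel)"
    by (rule pair_sigma_finite.Fubini'[OF sf, symmetric]) measurable
  finally show ?thesis .
qed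

section \<open>Termwise integration and Appell's series\<close>

text \<open>The denominator factors as \<open>(a^2 * R * (1 - X - Y))^2\<close> with
  \<open>X = x / R\<close> and \<open>Y = y * q^2 / R\<close>, and \<open>sqrt R / R^2\<close> is
  the power of \<open>R\<close> with exponent -3/2. The ordering of the semi-axes makes
  \<open>x\<close> and \<open>y\<close> nonnegative.\<close>

lemma slope_integrand_expansion:
  fixes a b c p q :: real
  assumes ab: "a \<ge> b" and bc: "b \<ge> c" and c: "c > 0"
  defines "x \<equiv> 1 - b\<^sup>2 / a\<^sup>2" and "y \<equiv> 1 - c\<^sup>2 / a\<^sup>2"
  shows "((\<lambda>(m, n). b\<^sup>2 * c\<^sup>2 / a\<^sup>2 * (pochhammer 2 (m + n) / (fact m * fact n) * x ^ m * y ^ n)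
            * (q ^ (2 * n) * (1 + p\<^sup>2 + q\<^sup>2) powr - (3/2 + real m + real n)))
     has_sum a\<^sup>2 * b\<^sup>2 * c\<^sup>2 * sqrt (1 + p\<^sup>2 + q\<^sup>2) / (a\<^sup>2 * p\<^sup>2 + b\<^sup>2 + c\<^sup>2 * q\<^sup>2)\<^sup>2) UNIV"
proof -
  define R where "R = 1 + p\<^sup>2 + q\<^sup>2"
  define X where "X = x / R"
  define Y where "Y = y * q\<^sup>2 / R"
  have a: "a > 0" "b > 0" using assms by auto
  have R: "R > 0" unfolding R_def by (intro add_pos_nonneg) auto
  have xy: "x \<ge> 0" "y \<ge> 0"
    using ab bc c by (auto simp: x_def y_def divide_le_eq intro!: power_mono)
  have den: "a\<^sup>2 * p\<^sup>2 + b\<^sup>2 + c\<^sup>2 * q\<^sup>2 = a\<^sup>2 * R * (1 - X - Y)"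
  proof -
    have ax: "a\<^sup>2 * x = a\<^sup>2 - b\<^sup>2" and ay: "a\<^sup>2 * y = a\<^sup>2 - c\<^sup>2"
      using a by (simp_all add: x_def y_def field_simps)
    have "a\<^sup>2 * R * (1 - X - Y) = a\<^sup>2 * R - a\<^sup>2 * x - a\<^sup>2 * y * q\<^sup>2"
      using R by (simp add: X_def Y_def field_simps)
    also have "\<dots> = a\<^sup>2 * p\<^sup>2 + b\<^sup>2 + c\<^sup>2 * q\<^sup>2"
      unfolding ax ay by (simp add: R_def algebra_simps)
    finally show ?thesis by simp
  qed
  \<comment> \<open>By the factorisation, positivity of the denominator says that
    \<open>X + Y < 1\<close>, the convergence condition of the series.\<close>
  have "a\<^sup>2 * p\<^sup>2 + b\<^sup>2 + c\<^sup>2 * q\<^sup>2 > 0"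
    using a by (intro add_pos_nonneg add_nonneg_pos) auto
  moreover have "a\<^sup>2 * R > 0" using R a by simp
  ultimately have "1 - X - Y > 0" unfolding den by (simp only: zero_less_mult_pos)
  then have "((\<lambda>(m, n). pochhammer 2 (m + n) / (fact m * fact n) * X ^ m * Y ^ n) has_sum 1 / (1 - X - Y)\<^sup>2) UNIV"
    using xy R by (intro has_sum_negative_binomial_two) (auto simp: X_def Y_def)
  then have "((\<lambda>v. b\<^sup>2 * c\<^sup>2 / a\<^sup>2 * R powr - (3/2) * (case v of (m, n) \<Rightarrow> pochhammer 2 (m + n) / (fact m * fact n) * X ^ m * Y ^ n))
     has_sum b\<^sup>2 * c\<^sup>2 / a\<^sup>2 * R powr - (3/2) * (1 / (1 - X - Y)\<^sup>2)) UNIV"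
    by (rule has_sum_cmult_right)
  also have "(\<lambda>v. b\<^sup>2 * c\<^sup>2 / a\<^sup>2 * R powr - (3/2) * (case v of (m, n) \<Rightarrow> pochhammer 2 (m + n) / (fact m * fact n) * X ^ m * Y ^ n))
     = (\<lambda>(m, n). b\<^sup>2 * c\<^sup>2 / a\<^sup>2 * (pochhammer 2 (m + n) / (fact m * fact n) * x ^ m * y ^ n)
            * (q ^ (2 * n) * R powr - (3/2 + real m + real n)))"
  proof (intro ext, clarify)
    fix m n :: nat
    have "- (3/2 + real m + real n) = - (3/2) - (real m + real n)" by simp
    then have "R powr - (3/2 + real m + real n) = R powr - (3/2) / (R powr real m * R powr real n)"
      by (simp only: powr_diff powr_add)
    also have "\<dots> = R powr - (3/2) / (R ^ m * R ^ n)"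
      using R by (simp add: powr_realpow)
    finally have "R powr - (3/2 + real m + real n) = R powr - (3/2) / (R ^ m * R ^ n)" .
    then show "b\<^sup>2 * c\<^sup>2 / a\<^sup>2 * R powr - (3/2) * (pochhammer 2 (m + n) / (fact m * fact n) * X ^ m * Y ^ n)
       = b\<^sup>2 * c\<^sup>2 / a\<^sup>2 * (pochhammer 2 (m + n) / (fact m * fact n) * x ^ m * y ^ n)
            * (q ^ (2 * n) * R powr - (3/2 + real m + real n))"
      unfolding power_mult by (simp add: X_def Y_def power_divide power_mult_distrib mult_ac)
  qed
  also have "b\<^sup>2 * c\<^sup>2 / a\<^sup>2 * R powr - (3/2) * (1 / (1 - X - Y)\<^sup>2)
    = a\<^sup>2 * b\<^sup>2 * c\<^sup>2 * sqrt R / (a\<^sup>2 * R * (1 - X - Y))\<^sup>2"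
  proof -
    have "R powr - (3/2) = R powr (1/2) / R powr 2" by (simp flip: powr_diff)
    then have "R powr - (3/2) = sqrt R / R\<^sup>2" using R by (simp add: powr_half_sqrt)
    then have "b\<^sup>2 * c\<^sup>2 / a\<^sup>2 * R powr - (3/2) * (1 / u\<^sup>2) = a\<^sup>2 * b\<^sup>2 * c\<^sup>2 * sqrt R / (a\<^sup>2 * R * u)\<^sup>2" for u
      using a by (simp add: power2_eq_square field_simps)
    then show ?thesis .
  qed
  finally show ?thesis unfolding den[symmetric] by (simp add: R_def)
qed

text \<open>As \<open>c\<close> is the smallest semi-axis, the base of the denominator is at least
  \<open>c^2 * R\<close>. The integrand is thus dominated by a multiple of the one for the unit
  hemisphere, the moment with \<open>m = n = 0\<close>.\<close>

lemma slope_integral_finite: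
  fixes a b c :: real
  assumes ab: "a \<ge> b" and bc: "b \<ge> c" and c: "c > 0"
  shows "(\<integral>\<^sup>+q. \<integral>\<^sup>+p. ennreal (a\<^sup>2 * b\<^sup>2 * c\<^sup>2 * sqrt (1 + p\<^sup>2 + q\<^sup>2) / (a\<^sup>2 * p\<^sup>2 + b\<^sup>2 + c\<^sup>2 * q\<^sup>2)\<^sup>2) \<partial>lborel \<partial>lborel) < \<infinity>"
proof -
  let ?K = "a\<^sup>2 * b\<^sup>2 / c\<^sup>2"
  have "(\<integral>\<^sup>+q. \<integral>\<^sup>+p. ennreal (a\<^sup>2 * b\<^sup>2 * c\<^sup>2 * sqrt (1 + p\<^sup>2 + q\<^sup>2) / (a\<^sup>2 * p\<^sup>2 + b\<^sup>2 + c\<^sup>2 * q\<^sup>2)\<^sup>2) \<partial>lborel \<partial>lborel)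
     \<le> (\<integral>\<^sup>+q. \<integral>\<^sup>+p. ennreal ?K * ennreal (q ^ (2 * 0) * (1 + p\<^sup>2 + q\<^sup>2) powr - (3/2 + real 0 + real 0)) \<partial>lborel \<partial>lborel)"
  proof (intro nn_integral_mono)
    fix p q :: real
    define R where "R = 1 + p\<^sup>2 + q\<^sup>2"
    have R: "R > 0" unfolding R_def by (intro add_pos_nonneg) auto
    have "c\<^sup>2 * p\<^sup>2 \<le> a\<^sup>2 * p\<^sup>2" "c\<^sup>2 \<le> b\<^sup>2"
      using ab bc c by (auto intro!: mult_right_mono power_mono)
    then have "c\<^sup>2 * R \<le> a\<^sup>2 * p\<^sup>2 + b\<^sup>2 + c\<^sup>2 * q\<^sup>2" by (simp add: R_def algebra_simps)
    moreover have cR: "c\<^sup>2 * R > 0" using c R by simp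
    ultimately have "(c\<^sup>2 * R)\<^sup>2 \<le> (a\<^sup>2 * p\<^sup>2 + b\<^sup>2 + c\<^sup>2 * q\<^sup>2)\<^sup>2" by (intro power_mono) auto
    moreover from cR have "(c\<^sup>2 * R)\<^sup>2 > 0" by (rule zero_less_power)
    ultimately have "a\<^sup>2 * b\<^sup>2 * c\<^sup>2 * sqrt R / (a\<^sup>2 * p\<^sup>2 + b\<^sup>2 + c\<^sup>2 * q\<^sup>2)\<^sup>2 \<le> a\<^sup>2 * b\<^sup>2 * c\<^sup>2 * sqrt R / (c\<^sup>2 * R)\<^sup>2"
      using R by (intro frac_le) auto
    also have "\<dots> = ?K * R powr - (3/2)"
    proof -
      have "R powr - (3/2) = R powr (1/2) / R powr 2" by (simp flip: powr_diff)
      then have "R powr - (3/2) = sqrt R / R\<^sup>2" using R by (simp add: powr_half_sqrt)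
      then show ?thesis using c by (simp add: power_mult_distrib field_simps power2_eq_square)
    qed
    finally show "ennreal (a\<^sup>2 * b\<^sup>2 * c\<^sup>2 * sqrt (1 + p\<^sup>2 + q\<^sup>2) / (a\<^sup>2 * p\<^sup>2 + b\<^sup>2 + c\<^sup>2 * q\<^sup>2)\<^sup>2)
      \<le> ennreal ?K * ennreal (q ^ (2 * 0) * (1 + p\<^sup>2 + q\<^sup>2) powr - (3/2 + real 0 + real 0))"
      by (simp add: R_def ennreal_leI flip: ennreal_mult)
  qed
  also have "\<dots> = ennreal ?K * (\<integral>\<^sup>+q. \<integral>\<^sup>+p. ennreal (q ^ (2 * 0) * (1 + p\<^sup>2 + q\<^sup>2) powr - (3/2 + real 0 + real 0)) \<partial>lborel \<partial>lborel)"
    by (simp add: nn_integral_cmult)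
  also have "\<dots> < \<infinity>"
    unfolding nn_integral_spherical_moment by (simp add: ennreal_mult_less_top)
  finally show ?thesis .
qed

text \<open>All terms are nonnegative, so the series may be integrated termwise.
  \<open>prod_decode\<close> lists the pairs as a sequence, the form in which
  \<open>nn_integral_suminf\<close> applies, and is undone at the end.\<close>

lemma appell_F1_has_sum_slope_integral:
  fixes a b c :: real
  assumes ab: "a \<ge> b" and bc: "b \<ge> c" and c: "c > 0"
  defines "I \<equiv> (\<integral>\<^sup>+q. \<integral>\<^sup>+p. ennreal (a\<^sup>2 * b\<^sup>2 * c\<^sup>2 * sqrt (1 + p\<^sup>2 + q\<^sup>2) / (a\<^sup>2 * p\<^sup>2 + b\<^sup>2 + c\<^sup>2 * q\<^sup>2)\<^sup>2) \<partial>lborel \<partial>lborel)"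
  shows "((\<lambda>v. 2 * pi * b\<^sup>2 * c\<^sup>2 / a\<^sup>2 * appell_F1_term 2 (1/2) (1/2) (3/2) (1 - b\<^sup>2 / a\<^sup>2) (1 - c\<^sup>2 / a\<^sup>2) v)
     has_sum enn2real I) UNIV"
proof -
  define x where "x = 1 - b\<^sup>2 / a\<^sup>2"
  define y where "y = 1 - c\<^sup>2 / a\<^sup>2"
  define C where "C = (\<lambda>(m, n). b\<^sup>2 * c\<^sup>2 / a\<^sup>2 * (pochhammer 2 (m + n) / (fact m * fact n) * x ^ m * y ^ n))"
  define g where "g = (\<lambda>(m, n) p q. q ^ (2 * n) * (1 + p\<^sup>2 + q\<^sup>2) powr - (3/2 + real m + real n))"
  define T where "T = (\<lambda>v. 2 * pi * b\<^sup>2 * c\<^sup>2 / a\<^sup>2 * appell_F1_term 2 (1/2) (1/2) (3/2) x y v)"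
  have xy: "x \<ge> 0" "y \<ge> 0"
    using ab bc c by (auto simp: x_def y_def divide_le_eq intro!: power_mono)
  have C: "C v \<ge> 0" for v
    using xy by (auto simp: C_def pochhammer_nonneg split: prod.split)
  have g: "g v p q \<ge> 0" for v p q
    by (auto simp: g_def zero_le_even_power split: prod.split)
  have T: "T v \<ge> 0" for v
    using xy by (auto simp: T_def appell_F1_term_def pochhammer_nonneg split: prod.split)
  have [measurable]: "(\<lambda>(q, p). g v p q) \<in> borel_measurable (borel \<Otimes>\<^sub>M borel)" for v
    unfolding g_def by (cases v) simp
  \<comment> \<open>The coefficient \<open>(2)_(m+n) / (m! n!)\<close> comes from the binomial
    series, and the remaining Pochhammer symbols and the factor \<open>2 * pi\<close> from the
    moment.\<close>
  have moment: "(\<integral>\<^sup>+q. \<integral>\<^sup>+p. ennreal (C v * g v p q) \<partial>lborel \<partial>lborel) = ennreal (T v)" for v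
  proof -
    obtain m n where v: "v = (m, n)" by (cases v)
    have "(\<integral>\<^sup>+q. \<integral>\<^sup>+p. ennreal (C v * g v p q) \<partial>lborel \<partial>lborel)
      = ennreal (C v) * (\<integral>\<^sup>+q. \<integral>\<^sup>+p. ennreal (g v p q) \<partial>lborel \<partial>lborel)"
      using C g by (simp add: ennreal_mult nn_integral_cmult)
    also have "(\<integral>\<^sup>+q. \<integral>\<^sup>+p. ennreal (g v p q) \<partial>lborel \<partial>lborel)
      = ennreal (2 * pi * pochhammer (1/2) m * pochhammer (1/2) n / pochhammer (3/2) (m + n))"
      unfolding g_def v prod.case by (rule nn_integral_spherical_moment)
    also have "ennreal (C v) * \<dots> = ennreal (C v * (2 * pi * pochhammer (1/2) m * pochhammer (1/2) n / pochhammer (3/2) (m + n)))"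
      by (rule ennreal_mult'[OF C, symmetric])
    also have "C v * (2 * pi * pochhammer (1/2) m * pochhammer (1/2) n / pochhammer (3/2) (m + n)) = T v"
      by (simp add: C_def T_def v appell_F1_term_def mult_ac)
    finally show ?thesis .
  qed
  have "ennreal (a\<^sup>2 * b\<^sup>2 * c\<^sup>2 * sqrt (1 + p\<^sup>2 + q\<^sup>2) / (a\<^sup>2 * p\<^sup>2 + b\<^sup>2 + c\<^sup>2 * q\<^sup>2)\<^sup>2)
     = (\<Sum>i. ennreal (C (prod_decode i) * g (prod_decode i) p q))" for p q
  proof -
    let ?s = "a\<^sup>2 * b\<^sup>2 * c\<^sup>2 * sqrt (1 + p\<^sup>2 + q\<^sup>2) / (a\<^sup>2 * p\<^sup>2 + b\<^sup>2 + c\<^sup>2 * q\<^sup>2)\<^sup>2"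
    have "((\<lambda>v. C v * g v p q) has_sum ?s) UNIV"
      using slope_integrand_expansion[OF ab bc c, of q p]
      by (simp add: C_def g_def x_def y_def case_prod_unfold)
    then have "((\<lambda>i. C (prod_decode i) * g (prod_decode i) p q) has_sum ?s) UNIV"
      by (subst has_sum_reindex_bij_betw[OF bij_prod_decode, of "\<lambda>v. C v * g v p q"])
    then have "(\<lambda>i. C (prod_decode i) * g (prod_decode i) p q) sums ?s"
      by (rule has_sum_imp_sums)
    then show ?thesis using C g by (intro suminf_ennreal_eq[symmetric]) auto
  qed
  then have "I = (\<integral>\<^sup>+q. \<integral>\<^sup>+p. (\<Sum>i. ennreal (C (prod_decode i) * g (prod_decode i) p q)) \<partial>lborel \<partial>lborel)"
    by (simp add: I_def)
  also have "\<dots> = (\<integral>\<^sup>+q. (\<Sum>i. \<integral>\<^sup>+p. ennreal (C (prod_decode i) * g (prod_decode i) p q) \<partial>lborel) \<partial>lborel)"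
    by (intro nn_integral_cong nn_integral_suminf) simp
  also have "\<dots> = (\<Sum>i. \<integral>\<^sup>+q. \<integral>\<^sup>+p. ennreal (C (prod_decode i) * g (prod_decode i) p q) \<partial>lborel \<partial>lborel)"
    by (intro nn_integral_suminf) simp
  also have "\<dots> = (\<Sum>i. ennreal (T (prod_decode i)))" by (simp add: moment)
  finally have I: "I = (\<Sum>i. ennreal (T (prod_decode i)))" .
  \<comment> \<open>Finiteness transfers the identity to the reals: without it
    \<open>enn2real\<close> would return 0 for an infinite integral.\<close>
  have "I < \<infinity>" unfolding I_def by (rule slope_integral_finite[OF ab bc c])
  then have "summable (\<lambda>i. T (prod_decode i))"
    unfolding I using T by (intro summable_suminf_not_top) auto
  then have "(\<lambda>i. T (prod_decode i)) sums enn2real I"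
    unfolding I using T by (simp add: suminf_ennreal2 suminf_nonneg summable_sums)
  then have "((\<lambda>i. T (prod_decode i)) has_sum enn2real I) UNIV"
    using T by (rule sums_nonneg_imp_has_sum)
  then have "(T has_sum enn2real I) UNIV"
    by (subst (asm) has_sum_reindex_bij_betw[OF bij_prod_decode])
  then show ?thesis by (simp add: T_def x_def y_def)
qed

text \<open>Integrability and summability are asserted along with the formula because the Lebesgue
  integral and \<open>infsum\<close> default to 0 otherwise; so neither side of the equation is a
  default value.\<close>

theorem theorem5:
  fixes a b c :: real
  assumes "a \<ge> b" and "b \<ge> c" and "c > 0"
    and "\<bar>1 - b\<^sup>2 / a\<^sup>2\<bar> < 1" and "\<bar>1 - c\<^sup>2 / a\<^sup>2\<bar> < 1"
  shows "set_integrable lborel (interior (elliptical_region a c)) (area_element (hemiellipsoid a b c))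
    \<and> appell_F1_term 2 (1/2) (1/2) (3/2) (1 - b\<^sup>2 / a\<^sup>2) (1 - c\<^sup>2 / a\<^sup>2) summable_on UNIV
    \<and> curved_surface_area (hemiellipsoid a b c) (elliptical_region a c)
        = 2 * pi * b\<^sup>2 * c\<^sup>2 / a\<^sup>2
          * appell_F1 2 (1/2) (1/2) (3/2) (1 - b\<^sup>2 / a\<^sup>2) (1 - c\<^sup>2 / a\<^sup>2)"
proof -
  have pos: "a > 0" "b > 0" "c > 0" using assms by auto
  define D where "D = {(x, z). x\<^sup>2 / a\<^sup>2 + z\<^sup>2 / c\<^sup>2 < 1}"
  define A where "A = (\<lambda>(x, z). sqrt (1 + (b\<^sup>2 * x\<^sup>2 / a ^ 4 + b\<^sup>2 * z\<^sup>2 / c ^ 4) / (1 - x\<^sup>2 / a\<^sup>2 - z\<^sup>2 / c\<^sup>2)))"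
  let ?F = "appell_F1_term 2 (1/2) (1/2) (3/2) (1 - b\<^sup>2 / a\<^sup>2) (1 - c\<^sup>2 / a\<^sup>2)"
  let ?K = "2 * pi * b\<^sup>2 * c\<^sup>2 / a\<^sup>2"
  let ?f = "\<lambda>v. indicator D v *\<^sub>R area_element (hemiellipsoid a b c) v"
  let ?I = "\<integral>\<^sup>+q. \<integral>\<^sup>+p. ennreal (a\<^sup>2 * b\<^sup>2 * c\<^sup>2 * sqrt (1 + p\<^sup>2 + q\<^sup>2) / (a\<^sup>2 * p\<^sup>2 + b\<^sup>2 + c\<^sup>2 * q\<^sup>2)\<^sup>2) \<partial>lborel \<partial>lborel"
  have int: "interior (elliptical_region a c) = D"
    unfolding D_def by (rule interior_elliptical_region) (use pos in auto)
  \<comment> \<open>The two functions agree at every point of the plane: outside \<open>D\<close>,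
    where \<open>deriv\<close> may be arbitrary, the indicator makes both zero.\<close>
  have f: "?f = (\<lambda>v. A v * indicator D v)"
    using area_element_hemiellipsoid[OF pos(1,3)]
    by (auto simp: fun_eq_iff A_def D_def indicator_def)
  have "D \<in> sets borel" using open_interior[of "elliptical_region a c"] by (simp add: int)
  moreover have "A \<in> borel_measurable borel"
    unfolding A_def borel_prod[symmetric] by measurable
  ultimately have meas: "?f \<in> borel_measurable lborel" unfolding f by simp
  have nonneg: "?f v \<ge> 0" for v
    by (cases v) (simp add: area_element_def)
  have nn: "(\<integral>\<^sup>+v. ennreal (?f v) \<partial>lborel) = ?I"
    using nn_integral_area_hemiellipsoid[OF pos, folded D_def A_def]
    unfolding fun_cong[OF f] by (simp add: ennreal_mult'' ennreal_indicator)
  have fin: "?I < \<infinity>" by (rule slope_integral_finite) (use assms in auto)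
  have "integrable lborel ?f"
    using meas
  proof (rule integrableI_nonneg)
    show "(\<integral>\<^sup>+v. ennreal (?f v) \<partial>lborel) < \<infinity>" unfolding nn by (rule fin)
  qed (use nonneg in simp)
  then have "set_integrable lborel (interior (elliptical_region a c)) (area_element (hemiellipsoid a b c))"
    by (simp add: set_integrable_def int)
  moreover have area: "curved_surface_area (hemiellipsoid a b c) (elliptical_region a c) = enn2real ?I"
    unfolding curved_surface_area_def set_lebesgue_integral_def int nn[symmetric]
    using meas nonneg by (intro integral_eq_nn_integral) auto
  moreover have sum: "((\<lambda>v. ?K * ?F v) has_sum enn2real ?I) UNIV"
    by (rule appell_F1_has_sum_slope_integral) (use assms in auto)
  moreover have K: "?K \<noteq> 0" using pos by simp
  moreover have "?F summable_on UNIV"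
    using has_sum_imp_summable[OF sum] K by (subst (asm) summable_on_cmult_right') auto
  moreover have "enn2real ?I = ?K * appell_F1 2 (1/2) (1/2) (3/2) (1 - b\<^sup>2 / a\<^sup>2) (1 - c\<^sup>2 / a\<^sup>2)"
    unfolding appell_F1_def infsum_cmult_right'[symmetric] using sum by (simp add: infsumI)
  ultimately show ?thesis by simp
qed

end
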